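(* Let $G=(V,E)$ be a finite simple graph with a proper edge colouring $c:E\to\{1,\dots,q\}$ and real amplitudes $\gamma_{jk}=\gamma_{kj}\ge0$ on its edges, and let $H_{\rm phys}=\sum_{\alpha=1}^q H_\alpha\otimes P_\alpha$ be the associated controlled Hamiltonian on $\mathbb C^{V}\otimes\mathbb C^q$ (defined in the context). Let $v\in V$ have $d$ incident edges $(v,u_\alpha)$ with mutually distinct colours $\alpha=1,\dots,d$, where edge $(v,u_\alpha)$ has colour $\alpha$. Assume that the two-vertex Hamiltonians of the edges $(v,u_\alpha)$, $\alpha=1,\dots,d$, have a common transfer time $t_*$. Then the evolution $e^{-\mathrm i t_*H_{\rm phys}/\hbar}$ maps $$|v\rangle\otimes\frac1{\sqrt d}\sum_{\alpha=1}^d|\alpha\rangle\quad\longmapsto\quad\frac1{\sqrt d}\sum_{\alpha=1}^d|u_\alpha\rangle\otimes|\alpha\rangle .$$ The final state has Schmidt rank $d$ (with respect to the tensor decomposition $\mathbb C^V\otimes\mathbb C^q$), entanglement entropy $\log_2 d$, and zero amplitude at every vertex outside $\{u_1,\dots,u_d\}$.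
   Context: Constants $\hbar,m>0$. $\{|j\rangle\}_{j\in V}$ and $\{|\alpha\rangle\}_{\alpha=1}^q$ are the standard orthonormal bases of $\mathbb C^V$ and $\mathbb C^q$, and $P_\alpha=|\alpha\rangle\langle\alpha|$. For an edge $\{j,k\}$ put $\kappa_{jk}=\hbar^2\gamma_{jk}^2/m$; its two-vertex Hamiltonian is $\kappa_{jk}(|j\rangle-|k\rangle)(\langle j|-\langle k|)$, i.e. $\kappa_{jk}\begin{pmatrix}1&-1\\-1&1\end{pmatrix}$ on $\operatorname{span}\{|j\rangle,|k\rangle\}$. The channel Hamiltonian is $H_\alpha=\sum_{\{j,k\}\in E,\ c(jk)=\alpha}\kappa_{jk}(|j\rangle-|k\rangle)(\langle j|-\langle k|)$. A transfer time of the edge $\{j,k\}$ is a time $t>0$ at which its two-vertex evolution carries $|j\rangle$ to $|k\rangle$ with probability one, i.e. $|\sin(\kappa_{jk}t/\hbar)|=1$ (the first such time is $t=\pi\hbar/(2\kappa_{jk})$). Entanglement entropy is the base-$2$ von Neumann entropy of the reduced density matrix on either tensor factor. *)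

theory Defs
  imports "HOL-Analysis.Analysis"
begin

text \<open>The space $\mathbb{C}^V$ is \<^typ>\<open>complex^'v\<close>, and the tensor product
  $\mathbb{C}^V \otimes \mathbb{C}^q$ is \<^typ>\<open>complex^('v \<times> 'q)\<close>, where the product basis
  vector $|j\rangle \otimes |\alpha\rangle$ has index \<open>(j, \<alpha>)\<close>. The colours $1,\ldots,q$ are the
  elements of the finite type \<open>'q\<close>.\<close>

section \<open>Vectors and matrices\<close>

definition ket :: "'n::finite \<Rightarrow> complex^'n" where
  "ket i = axis i 1"

definition braket :: "complex^'n::finite \<Rightarrow> complex^'n \<Rightarrow> complex" where
  "braket x y = (\<Sum>i\<in>UNIV. cnj (x $ i) * y $ i)"

definition ketbra :: "complex^'n::finite \<Rightarrow> complex^'n \<Rightarrow> complex^'n^'n" where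
  "ketbra x y = (\<chi> i j. x $ i * cnj (y $ j))"

definition smult_mat :: "complex \<Rightarrow> complex^'n::finite^'n \<Rightarrow> complex^'n^'n"
    (infixr \<open>*\<^sub>M\<close> 70) where
  "z *\<^sub>M A = (\<chi> i j. z * A $ i $ j)"

definition tensor_vec :: "complex^'a::finite \<Rightarrow> complex^'b::finite \<Rightarrow> complex^('a \<times> 'b)"
    (infixr \<open>\<otimes>\<^sub>v\<close> 75) where
  "x \<otimes>\<^sub>v y = (\<chi> p. x $ fst p * y $ snd p)"

definition tensor_mat ::
  "complex^'a::finite^'a \<Rightarrow> complex^'b::finite^'b \<Rightarrow> complex^('a \<times> 'b)^('a \<times> 'b)"
    (infixr \<open>\<otimes>\<^sub>m\<close> 75) where
  "A \<otimes>\<^sub>m B = (\<chi> p r. A $ fst p $ fst r * B $ snd p $ snd r)"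

definition mat_exp :: "complex^'n::finite^'n \<Rightarrow> complex^'n^'n" where
  "mat_exp A = (\<Sum>k. (1 / fact k) *\<^sub>R (((**) A) ^^ k) (mat 1))"

definition evolution :: "real \<Rightarrow> complex^'n::finite^'n \<Rightarrow> real \<Rightarrow> complex^'n^'n" where
  "evolution hbar H t = mat_exp ((- \<i> * complex_of_real (t / hbar)) *\<^sub>M H)"

section \<open>Coloured graphs and their Hamiltonians\<close>

definition simple_graph :: "'v set set \<Rightarrow> bool" where
  "simple_graph E \<longleftrightarrow> (\<forall>e\<in>E. card e = 2)"

definition proper_edge_colouring :: "'v set set \<Rightarrow> ('v set \<Rightarrow> 'q) \<Rightarrow> bool" where
  "proper_edge_colouring E c \<longleftrightarrow>
     (\<forall>e\<in>E. \<forall>f\<in>E. e \<noteq> f \<longrightarrow> e \<inter> f \<noteq> {} \<longrightarrow> c e \<noteq> c f)"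

definition coupling :: "real \<Rightarrow> real \<Rightarrow> ('v \<Rightarrow> 'v \<Rightarrow> real) \<Rightarrow> 'v \<Rightarrow> 'v \<Rightarrow> real" where
  "coupling hbar m \<gamma> j k = hbar\<^sup>2 * (\<gamma> j k)\<^sup>2 / m"

text \<open>The two-vertex Hamiltonian is taken as an operator on all of $\mathbb{C}^V$, vanishing on the
  orthogonal complement of $\mathrm{span}\{|j\rangle, |k\rangle\}$.\<close>

definition two_vertex_hamiltonian :: "real \<Rightarrow> 'v::finite \<Rightarrow> 'v \<Rightarrow> complex^'v^'v" where
  "two_vertex_hamiltonian \<kappa> j k = complex_of_real \<kappa> *\<^sub>M ketbra (ket j - ket k) (ket j - ket k)"

text \<open>The sum runs over ordered pairs \<open>(j, k)\<close>, so each edge \<open>{j, k}\<close> occurs twice, with the same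
  summand when \<open>\<gamma>\<close> is symmetric on edges; hence the factor \<open>1/2\<close>.\<close>

definition channel_hamiltonian ::
  "real \<Rightarrow> real \<Rightarrow> 'v::finite set set \<Rightarrow> ('v set \<Rightarrow> 'q) \<Rightarrow> ('v \<Rightarrow> 'v \<Rightarrow> real) \<Rightarrow> 'q \<Rightarrow> complex^'v^'v"
  where
  "channel_hamiltonian hbar m E c \<gamma> \<alpha> =
     (1 / 2) *\<^sub>M (\<Sum>(j, k) \<in> {(j, k). {j, k} \<in> E \<and> c {j, k} = \<alpha>}.
                  two_vertex_hamiltonian (coupling hbar m \<gamma> j k) j k)"

definition controlled_hamiltonian ::
  "real \<Rightarrow> real \<Rightarrow> 'v::finite set set \<Rightarrow> ('v set \<Rightarrow> 'q::finite) \<Rightarrow> ('v \<Rightarrow> 'v \<Rightarrow> real)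
     \<Rightarrow> complex^('v \<times> 'q)^('v \<times> 'q)" where
  "controlled_hamiltonian hbar m E c \<gamma> =
     (\<Sum>\<alpha>\<in>UNIV. channel_hamiltonian hbar m E c \<gamma> \<alpha> \<otimes>\<^sub>m ketbra (ket \<alpha>) (ket \<alpha>))"

definition transfer_time :: "real \<Rightarrow> real \<Rightarrow> 'v::finite \<Rightarrow> 'v \<Rightarrow> real \<Rightarrow> bool" where
  "transfer_time hbar \<kappa> j k t \<longleftrightarrow>
     0 < t \<and>
     (cmod (braket (ket k) (evolution hbar (two_vertex_hamiltonian \<kappa> j k) t *v ket j)))\<^sup>2 = 1"

section \<open>Bipartite entanglement\<close>

definition orthonormal_family :: "nat \<Rightarrow> (nat \<Rightarrow> complex^'n::finite) \<Rightarrow> bool" where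
  "orthonormal_family r a \<longleftrightarrow> (\<forall>i<r. \<forall>j<r. braket (a i) (a j) = (if i = j then 1 else 0))"

definition schmidt_decomposition ::
  "complex^('a::finite \<times> 'b::finite) \<Rightarrow> nat \<Rightarrow> (nat \<Rightarrow> real)
     \<Rightarrow> (nat \<Rightarrow> complex^'a) \<Rightarrow> (nat \<Rightarrow> complex^'b) \<Rightarrow> bool" where
  "schmidt_decomposition \<psi> r s a b \<longleftrightarrow>
     (\<forall>i<r. 0 < s i) \<and> orthonormal_family r a \<and> orthonormal_family r b \<and>
     \<psi> = (\<Sum>i<r. complex_of_real (s i) *s (a i \<otimes>\<^sub>v b i))"

definition schmidt_rank :: "complex^('a::finite \<times> 'b::finite) \<Rightarrow> nat" where
  "schmidt_rank \<psi> = (THE r. \<exists>s a b. schmidt_decomposition \<psi> r s a b)"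

text \<open>\<open>reduced_fst\<close> and \<open>reduced_snd\<close> are the reduced density matrices on the first and on the
  second tensor factor: the other factor is traced out of $|\psi\rangle\langle\psi|$.\<close>

definition reduced_fst :: "complex^('a::finite \<times> 'b::finite) \<Rightarrow> complex^'a^'a" where
  "reduced_fst \<psi> = (\<chi> i j. \<Sum>\<beta>\<in>UNIV. ketbra \<psi> \<psi> $ (i, \<beta>) $ (j, \<beta>))"

definition reduced_snd :: "complex^('a::finite \<times> 'b::finite) \<Rightarrow> complex^'b^'b" where
  "reduced_snd \<psi> = (\<chi> \<alpha> \<beta>. \<Sum>i\<in>UNIV. ketbra \<psi> \<psi> $ (i, \<alpha>) $ (i, \<beta>))"

definition eigenspace :: "complex^'n::finite^'n \<Rightarrow> real \<Rightarrow> (complex^'n) set" where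
  "eigenspace \<rho> \<mu> = {x. \<rho> *v x = complex_of_real \<mu> *s x}"

text \<open>The von Neumann entropy $-\mathrm{tr}(\rho \log_2 \rho)$ of a density matrix, which is Hermitian:
  all eigenvalues are real, and their multiplicities are the complex dimensions of the
  eigenspaces. The convention $0 \log_2 0 = 0$ is automatic, because of the factor \<open>\<mu> = 0\<close>.\<close>

definition von_neumann_entropy :: "complex^'n::finite^'n \<Rightarrow> real" where
  "von_neumann_entropy \<rho> =
     - (\<Sum>\<mu> | eigenspace \<rho> \<mu> \<noteq> {0}. real (vec.dim (eigenspace \<rho> \<mu>)) * (\<mu> * log 2 \<mu>))"

end

theory Submission
  imports Defs
begin

text \<open>On an edge \<open>{j, k}\<close> the two-vertex Hamiltonian has the eigenvectors \<open>|j\<rangle> + |k\<rangle>\<close> and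
  \<open>|j\<rangle> - |k\<rangle>\<close> with eigenvalues \<open>0\<close> and \<open>2 \<kappa>\<close>; by properness of the colouring, so
  has the controlled Hamiltonian after tensoring with the colour of the edge. Hence
  \<open>|j\<rangle>\<close> evolves to \<open>(1 + z)/2 |j\<rangle> + (1 - z)/2 |k\<rangle>\<close> with \<open>|z| = 1\<close>, and a transfer
  time forces \<open>z = - 1\<close>. The final state is already in Schmidt form, because the
  neighbours \<open>u \<alpha>\<close> are distinct, and both of its reduced states are uniform on \<open>d\<close> basis
  vectors.\<close>

section \<open>Convergence of the matrix exponential and its action on eigenvectors\<close>

lemma linear_matrix_mul_left: "linear (\<lambda>X :: complex^'n::finite^'n. A ** X)"
  by (rule linearI) (simp_all add: matrix_matrix_mult_def vec_eq_iff sum.distrib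
      distrib_left scaleR_sum_right)

lemma linear_matrix_vector_left: "linear (\<lambda>X :: complex^'n::finite^'n. X *v x)"
  by (rule linearI) (simp_all add: matrix_vector_mult_def vec_eq_iff sum.distrib
      distrib_right scaleR_sum_right)

text \<open>Left multiplication by \<open>A\<close> is a bounded operator with some bound
  \<open>K\<close>, so the terms are dominated by a constant times
  \<open>K ^ k / fact k\<close>.\<close>

lemma summable_mat_exp:
  fixes A :: "complex^'n::finite^'n"
  shows "summable (\<lambda>k. (1 / fact k) *\<^sub>R (((**) A) ^^ k) (mat 1))"
proof -
  have "bounded_linear (\<lambda>X :: complex^'n^'n. A ** X)"
    using linear_matrix_mul_left[of A] by (simp only: linear_conv_bounded_linear)
  from bounded_linear.nonneg_bounded[OF this]
  obtain K where K: "\<And>X :: complex^'n^'n. norm (A ** X) \<le> norm X * K" "K \<ge> 0"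
    by blast
  have bound: "norm ((((**) A) ^^ k) (mat 1)) \<le> norm (mat 1 :: complex^'n^'n) * K ^ k" for k
  proof (induction k)
    case (Suc k)
    have "norm ((((**) A) ^^ Suc k) (mat 1)) \<le> norm ((((**) A) ^^ k) (mat 1)) * K"
      using K(1) by simp
    also have "\<dots> \<le> norm (mat 1 :: complex^'n^'n) * K ^ k * K"
      using Suc K(2) by (rule mult_right_mono)
    finally show ?case by (simp add: mult.assoc mult.commute[of K])
  qed simp
  have "summable (\<lambda>k. norm (mat 1 :: complex^'n^'n) * (inverse (fact k) * K ^ k))"
    by (rule summable_mult[OF summable_exp])
  then show ?thesis
  proof (rule summable_comparison_test')
    fix k :: nat
    show "norm ((1 / fact k) *\<^sub>R (((**) A) ^^ k) (mat 1))
        \<le> norm (mat 1 :: complex^'n^'n) * (inverse (fact k) * K ^ k)"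
      using mult_left_mono[OF bound[of k], of "inverse (fact k)"]
      by (simp add: divide_inverse ac_simps)
  qed
qed

text \<open>Evaluation at \<open>x\<close> is bounded linear in the matrix, so it passes through the
  series and leaves the scalar exponential series of \<open>l\<close>.\<close>

lemma mat_exp_eigenvector:
  fixes A :: "complex^'n::finite^'n"
  assumes "A *v x = l *s x"
  shows "mat_exp A *v x = exp l *s x"
proof -
  have pow: "(((**) A) ^^ k) (mat 1) *v x = l ^ k *s x" for k
  proof (induction k)
    case (Suc k)
    have "(((**) A) ^^ Suc k) (mat 1) *v x = A *v ((((**) A) ^^ k) (mat 1) *v x)"
      by (simp add: matrix_vector_mul_assoc)
    then show ?case
      using Suc assms by (simp add: vec.scale mult.commute)
  qed simp
  have "bounded_linear (\<lambda>X :: complex^'n^'n. X *v x)"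
    using linear_matrix_vector_left[of x] by (simp only: linear_conv_bounded_linear)
  from bounded_linear.sums[OF this summable_sums[OF summable_mat_exp[of A]]]
  have "(\<lambda>k. ((1 / fact k) *\<^sub>R (((**) A) ^^ k) (mat 1)) *v x) sums (mat_exp A *v x)"
    unfolding mat_exp_def .
  moreover have "((1 / fact k) *\<^sub>R (((**) A) ^^ k) (mat 1)) *v x = (l ^ k /\<^sub>R fact k) *s x" for k
    unfolding linear_cmul[OF linear_matrix_vector_left] pow by (simp add: vec_eq_iff divide_inverse)
  ultimately have "(\<lambda>k. (l ^ k /\<^sub>R fact k) *s x) sums (mat_exp A *v x)"
    by simp
  moreover have "bounded_linear (\<lambda>z. z *s x)"
    unfolding linear_conv_bounded_linear[symmetric]
    by (rule linearI) (simp_all add: vec_eq_iff distrib_right)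
  then have "(\<lambda>k. (l ^ k /\<^sub>R fact k) *s x) sums (exp l *s x)"
    using exp_converges[of l] bounded_linear.sums by blast
  ultimately show ?thesis
    using sums_unique2 by blast
qed

section \<open>Two-level evolution and transfer times\<close>

lemma smult_mat_vector_mult: "(z *\<^sub>M A) *v x = z *s (A *v x)"
  by (simp add: smult_mat_def matrix_vector_mult_def vec_eq_iff sum_distrib_left mult.assoc)

lemma sum_matrix_vector_mult:
  "(\<Sum>i\<in>I. A i) *v x = (\<Sum>i\<in>I. A i *v x)" for A :: "'i \<Rightarrow> complex^'n::finite^'n"
  using linear_sum[OF linear_matrix_vector_left] .

lemma ketbra_mult_vec: "ketbra x y *v w = braket y w *s x"
  by (simp add: ketbra_def braket_def matrix_vector_mult_def vec_eq_iff sum_distrib_left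
      sum_distrib_right ac_simps)

lemma braket_diff_left: "braket (x - y) w = braket x w - braket y w"
  by (simp add: braket_def left_diff_distrib sum_subtractf)

lemma braket_add_right: "braket x (y + w) = braket x y + braket x w"
  by (simp add: braket_def distrib_left sum.distrib)

lemma braket_scale_right: "braket x (z *s y) = z * braket x y"
  by (simp add: braket_def sum_distrib_left ac_simps)

lemma ket_nth: "ket i $ j = (if i = j then 1 else 0)"
  by (auto simp: ket_def axis_def)

lemma braket_ket: "braket (ket i) (ket j) = (if i = j then 1 else 0)"
proof -
  have "braket (ket i) (ket j) = (\<Sum>k\<in>UNIV. if k = j then if i = j then 1 else 0 else 0)"
    unfolding braket_def by (rule sum.cong) (auto simp: ket_nth)
  then show ?thesis by simp
qed

lemma evolution_eigenvector:
  assumes "H *v x = \<mu> *s x"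
  shows "evolution hbar H t *v x = exp (- \<i> * complex_of_real (t / hbar) * \<mu>) *s x"
  unfolding evolution_def
  by (rule mat_exp_eigenvector) (simp add: smult_mat_vector_mult assms)

text \<open>The phase picked up by \<open>ket j - ket k\<close>, whose eigenvalue is
  \<open>2 * \<kappa>\<close>; the sum \<open>ket j + ket k\<close> has eigenvalue 0 and stays
  fixed.\<close>

definition swap_phase :: "real \<Rightarrow> real \<Rightarrow> real \<Rightarrow> complex" where
  "swap_phase hbar \<kappa> t = exp (- \<i> * complex_of_real (t / hbar) * complex_of_real (2 * \<kappa>))"

text \<open>The vectors \<open>a\<close>, \<open>b\<close> are abstract so that the formula serves
  both a single edge and its copy tensored with a colour. It follows by writing \<open>a\<close> as
  half the sum of the eigenvectors \<open>a + b\<close> and \<open>a - b\<close>.\<close>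

lemma evolution_two_level:
  fixes H :: "complex^'n::finite^'n"
  assumes "H *v a = complex_of_real \<kappa> *s (a - b)"
    and "H *v b = complex_of_real \<kappa> *s (b - a)"
  shows "evolution hbar H t *v a =
    ((1 + swap_phase hbar \<kappa> t) / 2) *s a + ((1 - swap_phase hbar \<kappa> t) / 2) *s b"
proof -
  let ?U = "evolution hbar H t" and ?z = "swap_phase hbar \<kappa> t"
  have "H *v (a + b) = 0 *s (a + b)"
    unfolding vec.add assms by (simp add: vec_eq_iff algebra_simps)
  from evolution_eigenvector[OF this, of hbar t]
  have plus: "?U *v (a + b) = a + b" by simp
  have "H *v (a - b) = complex_of_real (2 * \<kappa>) *s (a - b)"
    unfolding vec.diff assms by (simp add: vec_eq_iff algebra_simps)
  from evolution_eigenvector[OF this, of hbar t]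
  have minus: "?U *v (a - b) = ?z *s (a - b)" by (simp add: swap_phase_def)
  have "a = (1/2) *s ((a + b) + (a - b))"
    by (simp add: vec_eq_iff)
  then have "?U *v a = (1/2) *s (?U *v (a + b) + ?U *v (a - b))"
    by (metis vec.add vec.scale)
  then show ?thesis
    unfolding plus minus by (simp add: vec_eq_iff field_simps)
qed

lemma two_vertex_hamiltonian_mult_vec:
  "two_vertex_hamiltonian \<kappa> j k *v x =
    (complex_of_real \<kappa> * (braket (ket j) x - braket (ket k) x)) *s (ket j - ket k)"
  by (simp add: two_vertex_hamiltonian_def smult_mat_vector_mult ketbra_mult_vec
      braket_diff_left vec_eq_iff algebra_simps)

text \<open>A transfer time makes the phase exactly \<open>- 1\<close>, so that the transferred amplitude
  \<open>(1 - z) / 2\<close> is \<open>1\<close> itself and not merely of modulus one: no relative phases between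
  channels arise.\<close>

lemma transfer_time_swap_phase:
  assumes "transfer_time hbar \<kappa> j k t" and "j \<noteq> k"
  shows "swap_phase hbar \<kappa> t = - 1"
proof -
  let ?z = "swap_phase hbar \<kappa> t"
  have "evolution hbar (two_vertex_hamiltonian \<kappa> j k) t *v ket j =
      ((1 + ?z) / 2) *s ket j + ((1 - ?z) / 2) *s ket k"
    using assms(2) by (intro evolution_two_level)
      (auto simp: two_vertex_hamiltonian_mult_vec braket_ket vec_eq_iff algebra_simps)
  then have "(cmod ((1 - ?z) / 2))\<^sup>2 = 1"
    using assms by (simp add: transfer_time_def braket_add_right braket_scale_right braket_ket)
  then have "(cmod (1 - ?z))\<^sup>2 = 4"
    by (simp add: norm_divide power_divide)
  moreover have "cmod ?z = 1"
    by (simp add: swap_phase_def)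
  then have "(Re ?z)\<^sup>2 + (Im ?z)\<^sup>2 = 1"
    by (metis cmod_power2 one_power2)
  \<comment> \<open>Since |z| = 1, |1 - z|^2 = 2 - 2 Re z, so the value 4 gives Re z = -1; the
    circle equation then leaves Im z = 0.\<close>
  ultimately have "Re ?z = - 1" and "(Re ?z)\<^sup>2 + (Im ?z)\<^sup>2 = 1"
    by (auto simp: cmod_power2 power2_diff)
  then show ?thesis
    by (simp add: complex_eq_iff)
qed

section \<open>Tensor products and the controlled Hamiltonian\<close>

lemma tensor_mat_mult_vec: "(A \<otimes>\<^sub>m B) *v (x \<otimes>\<^sub>v y) = (A *v x) \<otimes>\<^sub>v (B *v y)"
  by (simp add: tensor_mat_def tensor_vec_def matrix_vector_mult_def vec_eq_iff
      sum_product sum.cartesian_product case_prod_beta ac_simps)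

lemma tensor_vec_diff_left: "(x - y) \<otimes>\<^sub>v w = x \<otimes>\<^sub>v w - y \<otimes>\<^sub>v w"
  by (simp add: tensor_vec_def vec_eq_iff left_diff_distrib)

lemma tensor_vec_scale_left: "(z *s x) \<otimes>\<^sub>v w = z *s (x \<otimes>\<^sub>v w)"
  by (simp add: tensor_vec_def vec_eq_iff mult.assoc)

lemma tensor_vec_scale_right: "x \<otimes>\<^sub>v (z *s w) = z *s (x \<otimes>\<^sub>v w)"
  by (simp add: tensor_vec_def vec_eq_iff ac_simps)

lemma tensor_vec_sum_right: "x \<otimes>\<^sub>v (\<Sum>i\<in>I. w i) = (\<Sum>i\<in>I. x \<otimes>\<^sub>v w i)"
  by (simp add: tensor_vec_def vec_eq_iff sum_distrib_left)

text \<open>The projector of colour \<open>\<beta>\<close> kills \<open>ket \<alpha>\<close> unless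
  \<open>\<beta> = \<alpha>\<close>, so the colour register merely selects a channel.\<close>

lemma controlled_hamiltonian_mult_ket:
  "controlled_hamiltonian hbar m E c \<gamma> *v (x \<otimes>\<^sub>v ket \<alpha>) =
    (channel_hamiltonian hbar m E c \<gamma> \<alpha> *v x) \<otimes>\<^sub>v ket \<alpha>"
proof -
  have "controlled_hamiltonian hbar m E c \<gamma> *v (x \<otimes>\<^sub>v ket \<alpha>) =
      (\<Sum>\<beta>\<in>UNIV. if \<beta> = \<alpha> then (channel_hamiltonian hbar m E c \<gamma> \<alpha> *v x) \<otimes>\<^sub>v ket \<alpha> else 0)"
    unfolding controlled_hamiltonian_def sum_matrix_vector_mult
    by (rule sum.cong) (auto simp: tensor_mat_mult_vec ketbra_mult_vec braket_ket
        tensor_vec_scale_right)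
  then show ?thesis by simp
qed

text \<open>Properness: \<open>{j, k}\<close> is the only edge of its colour at \<open>j\<close>, and it occurs as the two ordered
  pairs \<open>(j, k)\<close> and \<open>(k, j)\<close>, which cancels the factor \<open>1/2\<close>.\<close>

lemma channel_hamiltonian_mult_ket:
  assumes E: "simple_graph E" "proper_edge_colouring E c"
    and sym: "\<gamma> j k = \<gamma> k j"
    and edge: "{j, k} \<in> E" "c {j, k} = \<alpha>"
  shows "channel_hamiltonian hbar m E c \<gamma> \<alpha> *v ket j =
    complex_of_real (coupling hbar m \<gamma> j k) *s (ket j - ket k)"
proof -
  have "j \<noteq> k"
    using E(1) edge(1) by (auto simp: simple_graph_def)
  let ?S = "{(a, b). {a, b} \<in> E \<and> c {a, b} = \<alpha>}"
  let ?f = "\<lambda>(a, b). two_vertex_hamiltonian (coupling hbar m \<gamma> a b) a b *v ket j"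
  have only: "{a, b} = {j, k}" if "{a, b} \<in> E" "c {a, b} = \<alpha>" "a = j \<or> b = j" for a b
  proof -
    have "{a, b} \<inter> {j, k} \<noteq> {}"
      using that(3) by auto
    then show ?thesis
      using E(2) edge that(1,2) unfolding proper_edge_colouring_def by metis
  qed
  have "sum ?f ?S = sum ?f {(j, k), (k, j)}"
  proof (rule sum.mono_neutral_right)
    show "{(j, k), (k, j)} \<subseteq> ?S"
      using edge by (auto simp: insert_commute)
    show "\<forall>p\<in>?S - {(j, k), (k, j)}. ?f p = 0"
    proof
      fix p assume p: "p \<in> ?S - {(j, k), (k, j)}"
      obtain a b where ab: "p = (a, b)" by fastforce
      \<comment> \<open>A pair meeting \<open>j\<close> would be the edge \<open>{j, k}\<close>,
        excluded here; with neither endpoint at \<open>j\<close>, both overlaps with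
        \<open>ket j\<close> vanish.\<close>
      have "a \<noteq> j \<and> b \<noteq> j"
        using only[of a b] p unfolding ab by (auto simp: doubleton_eq_iff)
      then show "?f p = 0"
        by (simp add: ab two_vertex_hamiltonian_mult_vec braket_ket)
    qed
  qed simp
  also have "\<dots> = complex_of_real (2 * coupling hbar m \<gamma> j k) *s (ket j - ket k)"
    using \<open>j \<noteq> k\<close> sym
    by (simp add: two_vertex_hamiltonian_mult_vec braket_ket coupling_def vec_eq_iff algebra_simps)
  finally show ?thesis
    by (simp add: channel_hamiltonian_def smult_mat_vector_mult sum_matrix_vector_mult
        case_prod_beta)
qed

text \<open>The two endpoints tensored with \<open>ket \<alpha>\<close> span an invariant plane, so
  the two-level formula applies; phase -1 turns its coefficients (1 + z)/2 and (1 - z)/2 into 0 and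
  1.\<close>

lemma controlled_transfer:
  assumes E: "simple_graph E" "proper_edge_colouring E c"
    and sym: "\<gamma> j k = \<gamma> k j"
    and edge: "{j, k} \<in> E" "c {j, k} = \<alpha>"
    and tt: "transfer_time hbar (coupling hbar m \<gamma> j k) j k t"
  shows "evolution hbar (controlled_hamiltonian hbar m E c \<gamma>) t *v (ket j \<otimes>\<^sub>v ket \<alpha>) =
    ket k \<otimes>\<^sub>v ket \<alpha>"
proof -
  have "j \<noteq> k"
    using E(1) edge(1) by (auto simp: simple_graph_def)
  \<comment> \<open>The same edge read from \<open>k\<close> supplies the second two-level
    relation.\<close>
  have edge': "{k, j} \<in> E" "c {k, j} = \<alpha>"
    using edge by (simp_all add: insert_commute)
  have coup: "coupling hbar m \<gamma> k j = coupling hbar m \<gamma> j k"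
    by (simp add: coupling_def sym)
  have 1: "controlled_hamiltonian hbar m E c \<gamma> *v (ket j \<otimes>\<^sub>v ket \<alpha>) =
      complex_of_real (coupling hbar m \<gamma> j k) *s (ket j \<otimes>\<^sub>v ket \<alpha> - ket k \<otimes>\<^sub>v ket \<alpha>)"
    by (simp add: controlled_hamiltonian_mult_ket
        channel_hamiltonian_mult_ket[OF E sym edge]
        tensor_vec_scale_left tensor_vec_diff_left)
  have 2: "controlled_hamiltonian hbar m E c \<gamma> *v (ket k \<otimes>\<^sub>v ket \<alpha>) =
      complex_of_real (coupling hbar m \<gamma> j k) *s (ket k \<otimes>\<^sub>v ket \<alpha> - ket j \<otimes>\<^sub>v ket \<alpha>)"
    by (simp add: controlled_hamiltonian_mult_ket
        channel_hamiltonian_mult_ket[OF E sym[symmetric] edge']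
        tensor_vec_scale_left tensor_vec_diff_left coup)
  show ?thesis
    unfolding evolution_two_level[OF 1 2] transfer_time_swap_phase[OF tt \<open>j \<noteq> k\<close>]
    by simp
qed

section \<open>Uniqueness of the Schmidt rank\<close>

lemma orthonormal_family_inj:
  assumes "orthonormal_family r a"
  shows "inj_on a {..<r}"
  using assms unfolding orthonormal_family_def inj_on_def
  by (metis lessThan_iff zero_neq_one)

lemma orthonormal_family_independent:
  fixes a :: "nat \<Rightarrow> complex^'n::finite"
  assumes "orthonormal_family r a"
  shows "vec.independent (a ` {..<r})"
proof (rule vec.independent_if_scalars_zero)
  fix f x assume 0: "(\<Sum>x\<in>a ` {..<r}. f x *s x) = 0" and "x \<in> a ` {..<r}"
  then obtain i where i: "i < r" "x = a i" by auto
  \<comment> \<open>Pairing with \<open>a i\<close> isolates its coefficient.\<close>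
  have "0 = braket (a i) (\<Sum>j<r. f (a j) *s a j)"
    using 0 by (simp add: sum.reindex[OF orthonormal_family_inj[OF assms]] braket_def)
  also have "\<dots> = (\<Sum>j<r. f (a j) * braket (a i) (a j))"
    unfolding braket_def
    by (simp add: sum_distrib_left mult.left_commute) (subst sum.swap, simp)
  also have "\<dots> = (\<Sum>j<r. if i = j then f (a j) else 0)"
    using assms i by (intro sum.cong) (auto simp: orthonormal_family_def)
  also have "\<dots> = f x" using i by simp
  finally show "f x = 0" by simp
qed simp

text \<open>Reading \<open>\<psi>\<close> as a matrix, the Schmidt vectors of the first factor form a basis of its range,
  so the number of terms is the rank of this matrix.\<close>

lemma schmidt_decomposition_rank:
  fixes \<psi> :: "complex^('a::finite \<times> 'b::finite)"
  assumes "schmidt_decomposition \<psi> r s a b"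
  shows "r = vec.dim (range (\<lambda>y. (\<chi> i \<beta>. \<psi> $ (i, \<beta>)) *v y))"
proof -
  let ?M = "(\<chi> i \<beta>. \<psi> $ (i, \<beta>)) :: complex^'b^'a"
  \<comment> \<open>\<open>braket\<close> conjugates its first argument while \<open>?M\<close> acts
    linearly on \<open>y\<close>; conjugating \<open>y\<close> beforehand compensates.\<close>
  let ?cc = "\<lambda>y :: complex^'b. \<chi> \<beta>. cnj (y $ \<beta>)"
  have s: "s i > 0" if "i < r" for i
    using assms that by (simp add: schmidt_decomposition_def)
  have oa: "orthonormal_family r a" and ob: "orthonormal_family r b"
    and \<psi>: "\<psi> = (\<Sum>i<r. complex_of_real (s i) *s (a i \<otimes>\<^sub>v b i))"
    using assms by (simp_all add: schmidt_decomposition_def)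
  have M: "?M *v y = (\<Sum>i<r. (complex_of_real (s i) * braket (?cc y) (b i)) *s a i)" for y
  proof -
    have "(?M *v y) $ k = (\<Sum>i<r. complex_of_real (s i) * braket (?cc y) (b i) * a i $ k)" for k
      unfolding matrix_vector_mult_def braket_def \<psi>
      by (simp add: tensor_vec_def sum_distrib_left sum_distrib_right ac_simps)
        (subst sum.swap, simp)
    then show ?thesis by (simp add: vec_eq_iff)
  qed
  have "range (\<lambda>y. ?M *v y) = vec.span (a ` {..<r})"
  proof
    show "range (\<lambda>y. ?M *v y) \<subseteq> vec.span (a ` {..<r})"
      unfolding M
      by (rule image_subsetI, rule vec.span_sum, rule vec.span_scale, rule vec.span_base) simp
    have sub: "vec.subspace (range (\<lambda>y. ?M *v y))"
      using vec.linear_subspace_image matrix_vector_mul_linear_gen vec.subspace_UNIV by blast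
    have "a i \<in> range (\<lambda>y. ?M *v y)" if "i < r" for i
    proof -
      \<comment> \<open>Orthonormality of \<open>b\<close> picks out the term of index
        \<open>i\<close>; dividing by \<open>s i > 0\<close> then gives a preimage of
        \<open>a i\<close>.\<close>
      have "?M *v ?cc (b i) = (\<Sum>j<r. if i = j then complex_of_real (s i) *s a i else 0)"
        unfolding M using ob that
        by (intro sum.cong) (auto simp: orthonormal_family_def)
      then have "?M *v ((1 / complex_of_real (s i)) *s ?cc (b i)) = a i"
        using that s[OF that] by (simp add: vec.scale)
      then show ?thesis by (metis rangeI)
    qed
    then show "vec.span (a ` {..<r}) \<subseteq> range (\<lambda>y. ?M *v y)"
      by (intro vec.span_minimal sub) auto
  qed
  then show ?thesis
    using vec.dim_span_eq_card_independent[OF orthonormal_family_independent[OF oa]]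
      card_image[OF orthonormal_family_inj[OF oa]] by simp
qed

text \<open>The \<open>THE\<close> in \<open>schmidt_rank\<close> calls for uniqueness: every
  decomposition has as many terms as the dimension of a range depending on \<open>\<psi>\<close>
  alone.\<close>

lemma schmidt_rank_eqI:
  assumes "schmidt_decomposition \<psi> r s a b"
  shows "schmidt_rank \<psi> = r"
  unfolding schmidt_rank_def
proof (rule the_equality)
  fix r' assume "\<exists>s a b. schmidt_decomposition \<psi> r' s a b"
  then show "r' = r"
    using schmidt_decomposition_rank[OF assms] by (blast dest: schmidt_decomposition_rank trans sym)
qed (use assms in blast)

section \<open>Entropy of a uniform diagonal state\<close>

text \<open>The matrix is a rank \<open>card S\<close> projector scaled by 1 /
  \<open>card S\<close>. That eigenvalue yields the whole entropy; a possible eigenvalue 0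
  contributes nothing.\<close>

lemma von_neumann_entropy_uniform:
  fixes \<rho> :: "complex^'n::finite^'n"
  assumes \<rho>: "\<And>i j. \<rho> $ i $ j = (if i = j \<and> i \<in> S then complex_of_real (1 / real (card S)) else 0)"
    and "S \<noteq> {}"
  shows "von_neumann_entropy \<rho> = log 2 (real (card S))"
proof -
  define p where "p = 1 / real (card S)"
  have p: "p > 0"
    using assms(2) by (simp add: p_def card_gt_0_iff)
  have nth: "(\<rho> *v x) $ i = (if i \<in> S then complex_of_real p * x $ i else 0)" for x i
  proof -
    have "(\<rho> *v x) $ i =
        (\<Sum>j\<in>UNIV. if i = j then (if i \<in> S then complex_of_real p * x $ i else 0) else 0)"
      unfolding matrix_vector_mult_def vec_lambda_beta by (rule sum.cong) (simp_all add: \<rho> p_def)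
    then show ?thesis by simp
  qed
  have eig: "eigenspace \<rho> \<mu> =
      {x. \<forall>i. (if i \<in> S then complex_of_real p * x $ i else 0) = complex_of_real \<mu> * x $ i}" for \<mu>
    by (simp add: eigenspace_def vec_eq_iff nth)
  have p_eig: "eigenspace \<rho> p = {x. \<forall>i. i \<notin> S \<longrightarrow> x $ i = 0}"
    unfolding eig using p by auto
  then have dim: "vec.dim (eigenspace \<rho> p) = card S"
    by (simp add: dim_substandard_cart)
  have p_ev: "eigenspace \<rho> p \<noteq> {0}"
  proof
    assume 0: "eigenspace \<rho> p = {0}"
    have "card S = 0"
      using dim unfolding 0 by simp
    then show False using p by (simp add: p_def)
  qed
  have ev: "\<mu> \<in> {0, p}" if ne: "eigenspace \<rho> \<mu> \<noteq> {0}" for \<mu>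
  proof -
    have "0 \<in> eigenspace \<rho> \<mu>"
      by (simp add: eigenspace_def)
    with ne obtain x where x: "x \<in> eigenspace \<rho> \<mu>" "x \<noteq> 0"
      by blast
    then obtain i where i: "x $ i \<noteq> 0"
      by (auto simp: vec_eq_iff)
    \<comment> \<open>At a nonzero coordinate, \<open>i \<in> S\<close> forces
      \<open>\<mu> = p\<close> and \<open>i \<notin> S\<close> forces
      \<open>\<mu> = 0\<close>.\<close>
    have "(if i \<in> S then complex_of_real p * x $ i else 0) = complex_of_real \<mu> * x $ i"
      using x(1) unfolding eig by blast
    then show ?thesis
      using i by (simp split: if_splits)
  qed
  have "(\<Sum>\<mu> | eigenspace \<rho> \<mu> \<noteq> {0}. real (vec.dim (eigenspace \<rho> \<mu>)) * (\<mu> * log 2 \<mu>))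
      = (\<Sum>\<mu>\<in>{p}. real (vec.dim (eigenspace \<rho> \<mu>)) * (\<mu> * log 2 \<mu>))"
  proof (rule sum.mono_neutral_right)
    show "finite {\<mu>. eigenspace \<rho> \<mu> \<noteq> {0}}"
      by (rule finite_subset[of _ "{0, p}"]) (use ev in blast, simp)
    show "\<forall>\<mu>\<in>{\<mu>. eigenspace \<rho> \<mu> \<noteq> {0}} - {p}.
        real (vec.dim (eigenspace \<rho> \<mu>)) * (\<mu> * log 2 \<mu>) = 0"
      using ev by fastforce
  qed (use p_ev in blast)
  also have "\<dots> = log 2 p"
  proof -
    have "real (card S) * p = 1"
      using \<open>S \<noteq> {}\<close> by (simp add: p_def)
    then show ?thesis by (simp add: dim flip: mult.assoc)
  qed
  finally show ?thesis
    using \<open>S \<noteq> {}\<close> by (simp add: p_def von_neumann_entropy_def log_divide)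
qed

section \<open>Transfer out of \<open>v\<close> and entanglement of the final state\<close>

theorem theorem4p1:
  fixes hbar m t :: real
    and E :: "'v::finite set set"
    and c :: "'v set \<Rightarrow> 'q::finite"
    and \<gamma> :: "'v \<Rightarrow> 'v \<Rightarrow> real"
    and v :: 'v
    and d :: nat
    and D :: "'q set"
    and u :: "'q \<Rightarrow> 'v"
  assumes "0 < hbar" and "0 < m"
    and "simple_graph E"
    and "proper_edge_colouring E c"
    and "\<And>j k. {j, k} \<in> E \<Longrightarrow> \<gamma> j k = \<gamma> k j"
    and "\<And>j k. {j, k} \<in> E \<Longrightarrow> 0 \<le> \<gamma> j k"
    and "1 \<le> d" and "card D = d"
    and "\<And>\<alpha>. \<alpha> \<in> D \<Longrightarrow> {v, u \<alpha>} \<in> E"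
    and "\<And>\<alpha>. \<alpha> \<in> D \<Longrightarrow> c {v, u \<alpha>} = \<alpha>"
    and "\<And>\<alpha>. \<alpha> \<in> D \<Longrightarrow> transfer_time hbar (coupling hbar m \<gamma> v (u \<alpha>)) v (u \<alpha>) t"
  shows "let initial = ket v \<otimes>\<^sub>v (complex_of_real (1 / sqrt (real d)) *s (\<Sum>\<alpha>\<in>D. ket \<alpha>));
             final = complex_of_real (1 / sqrt (real d)) *s (\<Sum>\<alpha>\<in>D. ket (u \<alpha>) \<otimes>\<^sub>v ket \<alpha>)
         in evolution hbar (controlled_hamiltonian hbar m E c \<gamma>) t *v initial = final \<and>
            schmidt_rank final = d \<and>
            von_neumann_entropy (reduced_fst final) = log 2 (real d) \<and>
            von_neumann_entropy (reduced_snd final) = log 2 (real d) \<and>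
            (\<forall>w. w \<notin> u ` D \<longrightarrow> (\<forall>\<alpha>. final $ (w, \<alpha>) = 0))"
proof -
  define s where "s = 1 / sqrt (real d)"
  define final where
    "final = complex_of_real s *s (\<Sum>\<alpha>\<in>D. ket (u \<alpha>) \<otimes>\<^sub>v (ket \<alpha> :: complex^'q))"
  let ?U = "evolution hbar (controlled_hamiltonian hbar m E c \<gamma>) t"
  have s: "s > 0" "complex_of_real s * complex_of_real s = complex_of_real (1 / real d)"
    using \<open>1 \<le> d\<close> by (simp_all add: s_def flip: of_real_mult)
  have "D \<noteq> {}"
    using \<open>1 \<le> d\<close> \<open>card D = d\<close> by auto
  \<comment> \<open>The colour of the edge \<open>{v, u \<alpha>}\<close> recovers
    \<open>\<alpha>\<close>.\<close>
  have inj: "inj_on u D"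
    using assms(10) by (metis inj_onI)
  have step: "?U *v (ket v \<otimes>\<^sub>v ket \<alpha>) = ket (u \<alpha>) \<otimes>\<^sub>v ket \<alpha>" if "\<alpha> \<in> D" for \<alpha>
    using controlled_transfer[OF assms(3,4) assms(5)[OF assms(9)] assms(9-11)] that by blast
  have "?U *v (ket v \<otimes>\<^sub>v (complex_of_real s *s (\<Sum>\<alpha>\<in>D. ket \<alpha>))) =
      complex_of_real s *s (\<Sum>\<alpha>\<in>D. ?U *v (ket v \<otimes>\<^sub>v ket \<alpha>))"
    by (simp add: tensor_vec_scale_right tensor_vec_sum_right vec.scale vec.sum)
  also have "\<dots> = final"
    unfolding final_def by (simp add: step)
  finally have evol: "?U *v (ket v \<otimes>\<^sub>v (complex_of_real s *s (\<Sum>\<alpha>\<in>D. ket \<alpha>))) = final" .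
  \<comment> \<open>The reduced states and the support are read off from these amplitudes.\<close>
  have final_nth: "final $ (w, \<alpha>) = (if \<alpha> \<in> D \<and> w = u \<alpha> then complex_of_real s else 0)" for w \<alpha>
  proof -
    have "final $ (w, \<alpha>) = complex_of_real s * (\<Sum>\<beta>\<in>D. ket (u \<beta>) $ w * ket \<beta> $ \<alpha>)"
      by (simp add: final_def tensor_vec_def)
    moreover have "(\<Sum>\<beta>\<in>D. ket (u \<beta>) $ w * ket \<beta> $ \<alpha>) =
        (\<Sum>\<beta>\<in>D. if \<alpha> = \<beta> then if w = u \<alpha> then 1 else 0 else (0 :: complex))"
      by (rule sum.cong) (auto simp: ket_nth)
    ultimately show ?thesis by simp
  qed
  \<comment> \<open>Schmidt families are indexed by naturals, so \<open>D\<close> is enumerated;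
    injectivity of \<open>u\<close> makes the vertex family orthonormal.\<close>
  obtain h where h: "bij_betw h {..<d} D"
    using \<open>card D = d\<close> by (metis ex_bij_betw_nat_finite finite lessThan_atLeast0)
  then have h': "inj_on h {..<d}" "\<And>i. i < d \<Longrightarrow> h i \<in> D"
    by (auto simp: bij_betw_def)
  have "schmidt_decomposition final d (\<lambda>_. s) (\<lambda>i. ket (u (h i))) (\<lambda>i. ket (h i))"
    unfolding schmidt_decomposition_def orthonormal_family_def braket_ket
    using s(1) h' inj
    by (auto simp: final_def vec.scale_sum_right inj_on_eq_iff
        sum.reindex_bij_betw[OF h, of "\<lambda>\<alpha>. complex_of_real s *s (ket (u \<alpha>) \<otimes>\<^sub>v ket \<alpha>)"])
  then have rank: "schmidt_rank final = d"
    by (rule schmidt_rank_eqI)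
  have "reduced_fst final $ i $ j =
      (if i = j \<and> i \<in> u ` D then complex_of_real (1 / real (card (u ` D))) else 0)" for i j
  proof (cases "i = j \<and> i \<in> u ` D")
    case True
    then obtain \<alpha> where \<alpha>: "\<alpha> \<in> D" "i = u \<alpha>" "j = u \<alpha>" by auto
    \<comment> \<open>Injectivity of \<open>u\<close> leaves a single colour over the vertex
      \<open>i\<close>, contributing s^2 = 1/d.\<close>
    have "reduced_fst final $ i $ j = (\<Sum>\<beta>\<in>UNIV. if \<beta> = \<alpha> then complex_of_real (1 / real d) else 0)"
      unfolding reduced_fst_def ketbra_def vec_lambda_beta
      by (rule sum.cong) (use \<alpha> inj in \<open>auto simp: final_nth s(2) inj_on_eq_iff\<close>)
    then show ?thesis
      using \<alpha> by (simp add: card_image[OF inj] \<open>card D = d\<close>)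
  next
    case False
    \<comment> \<open>Off the diagonal a nonzero term would put one colour at two vertices; on it,
      \<open>i\<close> carries no amplitude.\<close>
    then show ?thesis
      by (auto simp: reduced_fst_def ketbra_def final_nth intro!: sum.neutral)
  qed
  then have fst: "von_neumann_entropy (reduced_fst final) = log 2 (real d)"
    using von_neumann_entropy_uniform[of "reduced_fst final" "u ` D"] \<open>D \<noteq> {}\<close> \<open>card D = d\<close>
    by (simp add: card_image[OF inj])
  have "reduced_snd final $ \<alpha> $ \<beta> =
      (if \<alpha> = \<beta> \<and> \<alpha> \<in> D then complex_of_real (1 / real (card D)) else 0)" for \<alpha> \<beta>
  proof (cases "\<alpha> = \<beta> \<and> \<alpha> \<in> D")
    case True
    have "reduced_snd final $ \<alpha> $ \<beta> =
        (\<Sum>i\<in>UNIV. if i = u \<alpha> then complex_of_real (1 / real d) else 0)"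
      unfolding reduced_snd_def ketbra_def vec_lambda_beta
      by (rule sum.cong) (use True in \<open>auto simp: final_nth s(2)\<close>)
    then show ?thesis
      using True \<open>card D = d\<close> by auto
  next
    case False
    \<comment> \<open>Off the diagonal a nonzero term would put two colours at one vertex, against
      injectivity of \<open>u\<close>.\<close>
    then show ?thesis
      using inj by (auto simp: reduced_snd_def ketbra_def final_nth inj_on_eq_iff intro!: sum.neutral)
  qed
  then have snd: "von_neumann_entropy (reduced_snd final) = log 2 (real d)"
    using von_neumann_entropy_uniform[of "reduced_snd final" D] \<open>D \<noteq> {}\<close> \<open>card D = d\<close>
    by auto
  have "\<forall>w. w \<notin> u ` D \<longrightarrow> (\<forall>\<alpha>. final $ (w, \<alpha>) = 0)"
    by (auto simp: final_nth)
  with evol rank fst snd show ?thesis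
    unfolding Let_def final_def s_def by simp
qed

end
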